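(* Let $(A,\circ,\mathfrak{B}_A)$ be a quadratic perm algebra and $(B,\cdot,\mathfrak{B}_B)$ be a symmetric Frobenius algebra. Then $(A\otimes B,\rhd_{A\otimes B},\lhd_{A\otimes B},\mathfrak{B}_{A\otimes B})$ is a skew-symmetric Frobenius dialgebra, where for all $x,y\in A$, $a,b\in B$, $$(x\otimes a)\rhd_{A\otimes B}(y\otimes b)=x\circ y\otimes a\cdot b,\qquad (x\otimes a)\lhd_{A\otimes B}(y\otimes b)=y\circ x\otimes a\cdot b,$$ $$\mathfrak{B}_{A\otimes B}(x\otimes a,y\otimes b)=\mathfrak{B}_A(x,y)\,\mathfrak{B}_B(a,b).$$
   Context: All vector spaces and algebras are finite-dimensional over a field $\mathbb F$ of characteristic $0$; algebras are not assumed unital. A perm algebra $(A,\circ)$ is a vector space with a bilinear product satisfying $(x\circ y)\circ z=x\circ(y\circ z)=y\circ(x\circ z)$ for all $x,y,z\in A$. A quadratic perm algebra $(A,\circ,\mathfrak{B})$ is a perm algebra with a nondegenerate skew-symmetric bilinear form satisfying $\mathfrak{B}(x\circ y,z)=\mathfrak{B}(x,y\circ z-z\circ y)$ for all $x,y,z$. A symmetric Frobenius algebra $(B,\cdot,\mathfrak{B})$ is an associative algebra with a nondegenerate symmetric bilinear form satisfying $\mathfrak{B}(x\cdot y,z)=\mathfrak{B}(x,y\cdot z)$. A dialgebra is a triple $(A,\rhd,\lhd)$ where $\rhd,\lhd$ are associative bilinear products on a vector space $A$ such that for all $x,y,z\in A$: $(x\lhd y)\lhd z=x\lhd(y\rhd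 z)$, $(x\rhd y)\lhd z=x\rhd(y\lhd z)$, $(x\lhd y)\rhd z=x\rhd(y\rhd z)$. A bilinear form $\mathfrak{B}$ on a dialgebra is invariant if $\mathfrak{B}(x\rhd y,z)=\mathfrak{B}(x,y\rhd z-y\lhd z)$ and $\mathfrak{B}(x\lhd y,z)=\mathfrak{B}(x,y\rhd z)$. A skew-symmetric Frobenius dialgebra is a dialgebra equipped with a nondegenerate skew-symmetric invariant bilinear form. *)

theory Defs
  imports Complex_Main "HOL-Library.Poly_Mapping"
begin

section \<open>Algebras and bilinear forms\<close>

text \<open>
  A vector space is a type together with its scalar multiplication, as in
  \<^locale>\<open>vector_space\<close>.  The class \<^class>\<open>field_char_0\<close> is that of all fields of
  characteristic zero.
\<close>

locale fin_dim_vector_space = vector_space scale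
  for scale :: "'f::field_char_0 \<Rightarrow> 'a::ab_group_add \<Rightarrow> 'a" +
  assumes finite_spanning_set: "\<exists>S. finite S \<and> span S = UNIV"

definition bilinear_map ::
  "('f::field_char_0 \<Rightarrow> 'a::ab_group_add \<Rightarrow> 'a) \<Rightarrow> ('f \<Rightarrow> 'b::ab_group_add \<Rightarrow> 'b) \<Rightarrow>
   ('f \<Rightarrow> 'c::ab_group_add \<Rightarrow> 'c) \<Rightarrow> ('a \<Rightarrow> 'b \<Rightarrow> 'c) \<Rightarrow> bool"
  where "bilinear_map sA sB sC f \<longleftrightarrow>
    (\<forall>x. Vector_Spaces.linear sB sC (f x)) \<and> (\<forall>y. Vector_Spaces.linear sA sC (\<lambda>x. f x y))"

abbreviation bilinear_product ::
  "('f::field_char_0 \<Rightarrow> 'a::ab_group_add \<Rightarrow> 'a) \<Rightarrow> ('a \<Rightarrow> 'a \<Rightarrow> 'a) \<Rightarrow> bool"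
  where "bilinear_product s mult \<equiv> bilinear_map s s s mult"

abbreviation bilinear_form ::
  "('f::field_char_0 \<Rightarrow> 'a::ab_group_add \<Rightarrow> 'a) \<Rightarrow> ('a \<Rightarrow> 'a \<Rightarrow> 'f) \<Rightarrow> bool"
  where "bilinear_form s \<beta> \<equiv> bilinear_map s s (*) \<beta>"

definition nondegenerate :: "('a::zero \<Rightarrow> 'a \<Rightarrow> 'f::zero) \<Rightarrow> bool"
  where "nondegenerate \<beta> \<longleftrightarrow>
    (\<forall>x. (\<forall>y. \<beta> x y = 0) \<longrightarrow> x = 0) \<and> (\<forall>y. (\<forall>x. \<beta> x y = 0) \<longrightarrow> y = 0)"

definition symmetric_form :: "('a \<Rightarrow> 'a \<Rightarrow> 'f) \<Rightarrow> bool"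
  where "symmetric_form \<beta> \<longleftrightarrow> (\<forall>x y. \<beta> x y = \<beta> y x)"

definition skew_symmetric_form :: "('a \<Rightarrow> 'a \<Rightarrow> 'f::uminus) \<Rightarrow> bool"
  where "skew_symmetric_form \<beta> \<longleftrightarrow> (\<forall>x y. \<beta> x y = - \<beta> y x)"

locale perm_algebra = fin_dim_vector_space scale
  for scale :: "'f::field_char_0 \<Rightarrow> 'a::ab_group_add \<Rightarrow> 'a" +
  fixes mult :: "'a \<Rightarrow> 'a \<Rightarrow> 'a"  (infixl "\<circ>\<^sub>p" 70)
  assumes bilinear: "bilinear_product scale mult"
    and assoc: "(x \<circ>\<^sub>p y) \<circ>\<^sub>p z = x \<circ>\<^sub>p (y \<circ>\<^sub>p z)"
    and left_commute: "x \<circ>\<^sub>p (y \<circ>\<^sub>p z) = y \<circ>\<^sub>p (x \<circ>\<^sub>p z)"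

locale quadratic_perm_algebra = perm_algebra scale mult
  for scale :: "'f::field_char_0 \<Rightarrow> 'a::ab_group_add \<Rightarrow> 'a"
    and mult :: "'a \<Rightarrow> 'a \<Rightarrow> 'a"  (infixl "\<circ>\<^sub>p" 70) +
  fixes form :: "'a \<Rightarrow> 'a \<Rightarrow> 'f"
  assumes form_bilinear: "bilinear_form scale form"
    and form_nondegenerate: "nondegenerate form"
    and form_skew: "skew_symmetric_form form"
    and form_invariant: "form (x \<circ>\<^sub>p y) z = form x (y \<circ>\<^sub>p z - z \<circ>\<^sub>p y)"

locale associative_algebra = fin_dim_vector_space scale
  for scale :: "'f::field_char_0 \<Rightarrow> 'a::ab_group_add \<Rightarrow> 'a" +
  fixes mult :: "'a \<Rightarrow> 'a \<Rightarrow> 'a"  (infixl "\<cdot>" 70)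
  assumes bilinear: "bilinear_product scale mult"
    and assoc: "(x \<cdot> y) \<cdot> z = x \<cdot> (y \<cdot> z)"

locale symmetric_Frobenius_algebra = associative_algebra scale mult
  for scale :: "'f::field_char_0 \<Rightarrow> 'a::ab_group_add \<Rightarrow> 'a"
    and mult :: "'a \<Rightarrow> 'a \<Rightarrow> 'a"  (infixl "\<cdot>" 70) +
  fixes form :: "'a \<Rightarrow> 'a \<Rightarrow> 'f"
  assumes form_bilinear: "bilinear_form scale form"
    and form_nondegenerate: "nondegenerate form"
    and form_symmetric: "symmetric_form form"
    and form_invariant: "form (x \<cdot> y) z = form x (y \<cdot> z)"

locale dialgebra =
  R: associative_algebra scale rmult + L: associative_algebra scale lmult
  for scale :: "'f::field_char_0 \<Rightarrow> 'a::ab_group_add \<Rightarrow> 'a"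
    and rmult :: "'a \<Rightarrow> 'a \<Rightarrow> 'a"  (infixl "\<rhd>" 70)
    and lmult :: "'a \<Rightarrow> 'a \<Rightarrow> 'a"  (infixl "\<lhd>" 70) +
  assumes left_bar: "(x \<lhd> y) \<lhd> z = x \<lhd> (y \<rhd> z)"
    and inner_assoc: "(x \<rhd> y) \<lhd> z = x \<rhd> (y \<lhd> z)"
    and right_bar: "(x \<lhd> y) \<rhd> z = x \<rhd> (y \<rhd> z)"

locale skew_symmetric_Frobenius_dialgebra = dialgebra scale rmult lmult
  for scale :: "'f::field_char_0 \<Rightarrow> 'a::ab_group_add \<Rightarrow> 'a"
    and rmult :: "'a \<Rightarrow> 'a \<Rightarrow> 'a"  (infixl "\<rhd>" 70)
    and lmult :: "'a \<Rightarrow> 'a \<Rightarrow> 'a"  (infixl "\<lhd>" 70) +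
  fixes form :: "'a \<Rightarrow> 'a \<Rightarrow> 'f"
  assumes form_bilinear: "bilinear_form scale form"
    and form_nondegenerate: "nondegenerate form"
    and form_skew: "skew_symmetric_form form"
    and form_invariant_right: "form (x \<rhd> y) z = form x (y \<rhd> z - y \<lhd> z)"
    and form_invariant_left: "form (x \<lhd> y) z = form x (y \<rhd> z)"


section \<open>Tensor products\<close>

text \<open>
  The vector space freely generated by a set is the space of finitely supported functions,
  with \<open>Poly_Mapping.single p 1\<close> the generator attached to \<open>p\<close>.
\<close>

definition free_scale :: "'f::field \<Rightarrow> ('p \<Rightarrow>\<^sub>0 'f) \<Rightarrow> ('p \<Rightarrow>\<^sub>0 'f)"
  where "free_scale c = Poly_Mapping.map ((*) c)"

definition free_lift ::
  "('f::field \<Rightarrow> 'c::ab_group_add \<Rightarrow> 'c) \<Rightarrow> ('p \<Rightarrow> 'c) \<Rightarrow> ('p \<Rightarrow>\<^sub>0 'f) \<Rightarrow> 'c"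
  where "free_lift s g u = (\<Sum>p\<in>Poly_Mapping.keys u. s (Poly_Mapping.lookup u p) (g p))"

abbreviation pure :: "'a \<Rightarrow> 'b \<Rightarrow> ('a \<times> 'b \<Rightarrow>\<^sub>0 'f::field)"
  where "pure x a \<equiv> Poly_Mapping.single (x, a) 1"

inductive_set tensor_relations ::
  "('f::field \<Rightarrow> 'a::ab_group_add \<Rightarrow> 'a) \<Rightarrow> ('f \<Rightarrow> 'b::ab_group_add \<Rightarrow> 'b) \<Rightarrow>
   ('a \<times> 'b \<Rightarrow>\<^sub>0 'f) set"
  for sA :: "'f::field \<Rightarrow> 'a::ab_group_add \<Rightarrow> 'a" and sB :: "'f \<Rightarrow> 'b::ab_group_add \<Rightarrow> 'b"
  where
    add_left: "pure (x + y) a - pure x a - pure y a \<in> tensor_relations sA sB"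
  | add_right: "pure x (a + b) - pure x a - pure x b \<in> tensor_relations sA sB"
  | scale_left: "pure (sA c x) a - free_scale c (pure x a) \<in> tensor_relations sA sB"
  | scale_right: "pure x (sB c a) - free_scale c (pure x a) \<in> tensor_relations sA sB"

text \<open>
  The usual construction of \<open>A \<otimes> B\<close> is the free vector space on \<open>A \<times> B\<close> modulo the span of the
  bilinearity relations.  That quotient depends on the two scalar multiplications, so it is not
  itself a type; instead, a space \<open>T\<close> with a map \<open>x \<otimes> a\<close> from \<open>A \<times> B\<close> is a tensor product of
  \<open>A\<close> and \<open>B\<close> if sending each generator \<open>(x, a)\<close> to \<open>x \<otimes> a\<close> identifies \<open>T\<close> with that quotient,
  i.e. is onto with kernel exactly the span of the relations.  The lemma \<open>universal_property\<close>
  below confirms that \<open>T\<close> is then determined by the usual universal property.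
\<close>

locale tensor_product =
  A: vector_space sA + B: vector_space sB + T: vector_space sT
  for sA :: "'f::field_char_0 \<Rightarrow> 'a::ab_group_add \<Rightarrow> 'a"
    and sB :: "'f \<Rightarrow> 'b::ab_group_add \<Rightarrow> 'b"
    and sT :: "'f \<Rightarrow> 't::ab_group_add \<Rightarrow> 't" +
  fixes tensor :: "'a \<Rightarrow> 'b \<Rightarrow> 't"  (infixl "\<otimes>" 75)
  assumes presentation_surj: "surj (free_lift sT (\<lambda>(x, a). x \<otimes> a))"
    and presentation_kernel:
      "{u. free_lift sT (\<lambda>(x, a). x \<otimes> a) u = 0} =
        module.span free_scale (tensor_relations sA sB)"

lemma lookup_free_scale [simp]:
  "Poly_Mapping.lookup (free_scale c u) p = c * Poly_Mapping.lookup u p"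
  by (simp add: free_scale_def Poly_Mapping.map.rep_eq when_def)

lemma vector_space_free_scale: "vector_space free_scale"
  by unfold_locales (auto intro!: poly_mapping_eqI simp: lookup_add algebra_simps)

lemma free_lift_superset:
  assumes "vector_space s" "finite S" "Poly_Mapping.keys u \<subseteq> S"
  shows "free_lift s g u = (\<Sum>p\<in>S. s (Poly_Mapping.lookup u p) (g p))"
proof -
  interpret vector_space s by fact
  show ?thesis unfolding free_lift_def
    by (rule sum.mono_neutral_left) (use assms in \<open>auto simp: in_keys_iff\<close>)
qed

lemma linear_free_lift:
  fixes g :: "'p \<Rightarrow> 'c::ab_group_add" and s :: "'f::field \<Rightarrow> 'c \<Rightarrow> 'c"
  assumes "vector_space s"
  shows "Vector_Spaces.linear free_scale s (free_lift s g)"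
proof -
  interpret F: vector_space free_scale by (rule vector_space_free_scale)
  interpret S: vector_space s by fact
  show ?thesis
  proof unfold_locales
    fix u v :: "'p \<Rightarrow>\<^sub>0 'f"
    let ?S = "Poly_Mapping.keys u \<union> Poly_Mapping.keys v"
    have "Poly_Mapping.keys (u + v) \<subseteq> ?S" by (rule keys_add)
    then show "free_lift s g (u + v) = free_lift s g u + free_lift s g v"
      by (simp add: free_lift_superset[OF assms, of ?S] lookup_add S.scale_left_distrib
          sum.distrib)
  next
    fix c and u :: "'p \<Rightarrow>\<^sub>0 'f"
    have "Poly_Mapping.keys (free_scale c u) \<subseteq> Poly_Mapping.keys u"
      by (auto simp: in_keys_iff)
    then show "free_lift s g (free_scale c u) = s c (free_lift s g u)"
      by (simp add: free_lift_superset[OF assms, of "Poly_Mapping.keys u"]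
          S.scale_sum_right)
  qed
qed

lemma free_lift_single [simp]:
  assumes "vector_space s"
  shows "free_lift s g (Poly_Mapping.single p 1) = g p"
proof -
  interpret vector_space s by fact
  show ?thesis by (simp add: free_lift_def)
qed

lemma free_lift_eq_0:
  assumes f: "bilinear_map sA sB sW f" and W: "vector_space sW"
    and u: "u \<in> module.span free_scale (tensor_relations sA sB)"
  shows "free_lift sW (\<lambda>(x, a). f x a) u = 0"
proof -
  interpret F: vector_space free_scale by (rule vector_space_free_scale)
  let ?L = "free_lift sW (\<lambda>(x, a). f x a)"
  interpret L: Vector_Spaces.linear free_scale sW ?L by (rule linear_free_lift[OF W])
  have l: "Vector_Spaces.linear sB sW (f x)" "Vector_Spaces.linear sA sW (\<lambda>x. f x a)" for x a
    using f by (auto simp: bilinear_map_def)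
  have add: "f (x + y) a = f x a + f y a" "f x (a + b) = f x a + f x b" for x y a b
    using module_hom.add[OF Vector_Spaces.linear.axioms(3)[OF l(2)]]
      module_hom.add[OF Vector_Spaces.linear.axioms(3)[OF l(1)]] by auto
  have sc: "f (sA c x) a = sW c (f x a)" "f x (sB c a) = sW c (f x a)" for c x a
    using module_hom.scale[OF Vector_Spaces.linear.axioms(3)[OF l(2)]]
      module_hom.scale[OF Vector_Spaces.linear.axioms(3)[OF l(1)]] by auto
  have "?L r = 0" if "r \<in> tensor_relations sA sB" for r
    using that by cases (simp_all add: L.diff L.scale free_lift_single[OF W] add sc)
  from L.eq_0_on_span[OF this u] show ?thesis .
qed

context tensor_product
begin

lemma bilinear_tensor: "bilinear_map sA sB sT tensor"
proof -
  interpret F: vector_space free_scale by (rule vector_space_free_scale)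
  let ?L = "free_lift sT (\<lambda>(x, a). x \<otimes> a)"
  interpret L: Vector_Spaces.linear free_scale sT ?L
    by (rule linear_free_lift) (rule T.vector_space_axioms)
  note one = free_lift_single[OF T.vector_space_axioms]
  have "?L r = 0" if "r \<in> tensor_relations sA sB" for r
    using presentation_kernel F.span_base[OF that] by auto
  from this[OF tensor_relations.add_left] this[OF tensor_relations.add_right]
    this[OF tensor_relations.scale_left] this[OF tensor_relations.scale_right]
  have "(x + y) \<otimes> a = x \<otimes> a + y \<otimes> a" "x \<otimes> (a + b) = x \<otimes> a + x \<otimes> b"
    "sA c x \<otimes> a = sT c (x \<otimes> a)" "x \<otimes> sB c a = sT c (x \<otimes> a)" for x y a b c
    by (simp_all add: L.diff L.add L.scale one diff_diff_eq)
  then show ?thesis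
    unfolding bilinear_map_def by (intro conjI allI; unfold_locales; simp)
qed

lemma linear_eqI:
  assumes g: "Vector_Spaces.linear sT sW g" and h: "Vector_Spaces.linear sT sW h"
    and eq: "\<And>x a. g (x \<otimes> a) = h (x \<otimes> a)"
  shows "g = h"
proof
  fix t
  interpret g: Vector_Spaces.linear sT sW g by fact
  interpret h: Vector_Spaces.linear sT sW h by fact
  obtain u where "t = free_lift sT (\<lambda>(x, a). x \<otimes> a) u"
    using presentation_surj by (metis surjD)
  then show "g t = h t"
    by (auto simp: free_lift_def g.sum h.sum g.scale h.scale eq intro!: sum.cong)
qed

lemma universal_property:
  assumes f: "bilinear_map sA sB sW f" and W: "vector_space sW"
  shows "\<exists>!g. Vector_Spaces.linear sT sW g \<and> (\<forall>x a. g (x \<otimes> a) = f x a)"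
proof (rule ex_ex1I)
  interpret F: vector_space free_scale by (rule vector_space_free_scale)
  interpret W: vector_space sW by fact
  let ?L = "free_lift sT (\<lambda>(x, a). x \<otimes> a)" and ?M = "free_lift sW (\<lambda>(x, a). f x a)"
  interpret L: Vector_Spaces.linear free_scale sT ?L
    by (rule linear_free_lift) (rule T.vector_space_axioms)
  interpret M: Vector_Spaces.linear free_scale sW ?M
    by (rule linear_free_lift) (rule W)
  define g where "g = (\<lambda>t. ?M (SOME u. ?L u = t))"
  have g: "g (?L u) = ?M u" for u
  proof -
    let ?v = "SOME v. ?L v = ?L u"
    have "?L ?v = ?L u" by (rule someI) (rule refl)
    then have "?L (?v - u) = 0" by (simp add: L.diff)
    then have "?M (?v - u) = 0"
      using presentation_kernel by (intro free_lift_eq_0[OF f W]) auto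
    then show ?thesis by (simp add: g_def M.diff)
  qed
  have ex: "\<exists>u. t = ?L u" for t
    using presentation_surj by (metis surjD)
  have "Vector_Spaces.linear sT sW g"
  proof unfold_locales
    show "g (s + t) = g s + g t" for s t
    proof -
      obtain u v where uv: "s = ?L u" "t = ?L v" using ex by blast
      show ?thesis unfolding uv L.add[symmetric] g M.add ..
    qed
    show "g (sT c t) = sW c (g t)" for c t
    proof -
      obtain u where u: "t = ?L u" using ex by blast
      show ?thesis unfolding u L.scale[symmetric] g M.scale ..
    qed
  qed
  moreover have "g (x \<otimes> a) = f x a" for x a
    using g[of "pure x a"]
    by (simp add: free_lift_single[OF T.vector_space_axioms] free_lift_single[OF W])
  ultimately show "\<exists>g. Vector_Spaces.linear sT sW g \<and> (\<forall>x a. g (x \<otimes> a) = f x a)" by blast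
qed (use linear_eqI in metis)

end

end

theory Submission
  imports Defs
begin

text \<open>
  Every tensor is a sum of pure tensors, so uniqueness of the structure maps and all identities
  reduce to pure tensors.  For nondegeneracy, write \<open>t = (\<Sum>b\<in>S. \<xi> b \<otimes> b)\<close> with \<open>S\<close> a basis of \<open>B\<close>.
  If \<open>t\<close> is orthogonal to every \<open>y \<otimes> c\<close>, then \<open>(\<Sum>b\<in>S. \<BB>\<^sub>A(\<xi> b, y) b)\<close> is orthogonal to \<open>B\<close>,
  hence zero, so each \<open>\<xi> b\<close> is orthogonal to \<open>A\<close> and therefore zero.
\<close>

section \<open>Bilinear maps, finite bases and the invariant form on \<open>A\<close>\<close>

lemma vector_space_times: "vector_space ((*) :: 'f::field \<Rightarrow> 'f \<Rightarrow> 'f)"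
  by unfold_locales (auto simp: algebra_simps)

text \<open>\<open>Vector_Spaces.linear\<close> carries the vector space axioms of its source and
  target, so these reappear as conjuncts. The remaining conjuncts are equations, which lets
  \<open>simp\<close> verify bilinearity of a concrete map.\<close>

lemma bilinear_map_iff:
  "bilinear_map sA sB sC f \<longleftrightarrow>
    vector_space sA \<and> vector_space sB \<and> vector_space sC \<and>
    (\<forall>x y a. f (x + y) a = f x a + f y a) \<and> (\<forall>x a b. f x (a + b) = f x a + f x b) \<and>
    (\<forall>c x a. f (sA c x) a = sC c (f x a)) \<and> (\<forall>c x a. f x (sB c a) = sC c (f x a))"
  unfolding bilinear_map_def Vector_Spaces.linear_iff by blast

lemma bilinear_map_simps:
  assumes "bilinear_map sA sB sC f"
  shows "f (x + y) a = f x a + f y a" "f x (a + b) = f x a + f x b"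
    "f (sA c x) a = sC c (f x a)" "f x (sB c a) = sC c (f x a)"
    "f 0 a = 0" "f x 0 = 0" "f (x - y) a = f x a - f y a" "f x (a - b) = f x a - f x b"
proof -
  show "f (x + y) a = f x a + f y a" "f x (a + b) = f x a + f x b"
    "f (sA c x) a = sC c (f x a)" "f x (sB c a) = sC c (f x a)"
    using assms by (auto simp: bilinear_map_iff)
  interpret l: Vector_Spaces.linear sA sC "\<lambda>x. f x a"
    using assms by (simp add: bilinear_map_def)
  interpret r: Vector_Spaces.linear sB sC "f x"
    using assms by (simp add: bilinear_map_def)
  show "f 0 a = 0" "f x 0 = 0" "f (x - y) a = f x a - f y a" "f x (a - b) = f x a - f x b"
    by (rule l.zero r.zero l.diff r.diff)+
qed

lemma bilinear_map_sum_left: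
  assumes "bilinear_map sA sB sC f"
  shows "f (sum g S) a = (\<Sum>i\<in>S. f (g i) a)"
proof -
  interpret Vector_Spaces.linear sA sC "\<lambda>x. f x a"
    using assms by (simp add: bilinear_map_def)
  show ?thesis by (rule sum)
qed

lemma bilinear_map_sum_right:
  assumes "bilinear_map sA sB sC f"
  shows "f x (sum g S) = (\<Sum>i\<in>S. f x (g i))"
proof -
  interpret Vector_Spaces.linear sB sC "f x"
    using assms by (simp add: bilinear_map_def)
  show ?thesis by (rule sum)
qed

lemma (in fin_dim_vector_space) finite_basis:
  obtains S where "finite S" "independent S" "span S = UNIV"
proof -
  obtain F where F: "finite F" "span F = UNIV" using finite_spanning_set by blast
  obtain S where "S \<subseteq> F" "independent S" "F \<subseteq> span S"
    using maximal_independent_subset by blast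
  with F show ?thesis
    by (metis that finite_subset span_minimal subspace_span top.extremum_uniqueI)
qed

text \<open>Skew-symmetry moves \<open>y \<circ>\<^sub>p z\<close> to the first slot; invariance
  then takes it apart and, read backwards, assembles \<open>y \<circ>\<^sub>p x\<close>. This is the
  invariance that the opposite product \<open>lmult\<close> on tensors requires.\<close>

lemma (in quadratic_perm_algebra) form_invariant_opposite:
  "form (y \<circ>\<^sub>p x) z = form x (y \<circ>\<^sub>p z)"
proof -
  note form_simps = bilinear_map_simps[OF form_bilinear]
  have "form x (y \<circ>\<^sub>p z) = - form (y \<circ>\<^sub>p z) x"
    using form_skew unfolding skew_symmetric_form_def by blast
  also have "\<dots> = form y (x \<circ>\<^sub>p z - z \<circ>\<^sub>p x)"
    by (simp add: form_invariant form_simps)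
  finally show ?thesis by (simp add: form_invariant)
qed

section \<open>Pure tensors and extension of bilinear maps\<close>

context tensor_product
begin

lemmas tensor_simps = bilinear_map_simps[OF bilinear_tensor]

text \<open>The presentation is onto, so each tensor is a finite linear combination of pure ones. No
  case for scalar multiples arises, because a scalar is absorbed into the left factor of a pure
  tensor.\<close>

lemma tensor_induct [case_names zero pure add]:
  assumes "P 0" "\<And>x a. P (x \<otimes> a)" "\<And>s t. P s \<Longrightarrow> P t \<Longrightarrow> P (s + t)"
  shows "P t"
proof -
  obtain u where u: "t = free_lift sT (\<lambda>(x, a). x \<otimes> a) u"
    using presentation_surj by (metis surjD)
  have "P (\<Sum>(x, a)\<in>K. sT (r (x, a)) (x \<otimes> a))" if "finite K" for K r
    using that by induction (auto simp: assms simp flip: tensor_simps(3))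
  then show ?thesis
    using finite_keys by (simp add: u free_lift_def case_prod_unfold)
qed

lemma bilinear_eqI:
  assumes f: "bilinear_map sT sT sW f" and g: "bilinear_map sT sT sW g"
    and eq: "\<And>x a y b. f (x \<otimes> a) (y \<otimes> b) = g (x \<otimes> a) (y \<otimes> b)"
  shows "f = g"
proof -
  note simps = bilinear_map_simps[OF f] bilinear_map_simps[OF g]
  have "f (x \<otimes> a) t = g (x \<otimes> a) t" for x a t
    by (induction t rule: tensor_induct) (simp_all add: simps eq)
  then have "f s t = g s t" for s t
    by (induction s rule: tensor_induct) (simp_all add: simps)
  then show ?thesis by blast
qed

text \<open>Pure tensors generate the additive group of the tensor product, so additivity in each
  slot carries an identity from pure tensors to all tensors. It serves the dialgebra axioms and the
  two invariance laws.\<close>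

lemma trilinear_eqI:
  fixes P Q :: "'t \<Rightarrow> 't \<Rightarrow> 't \<Rightarrow> 'w::ab_group_add"
  assumes "\<And>r r' s t. P (r + r') s t = P r s t + P r' s t" "\<And>s t. P 0 s t = 0"
    "\<And>r s s' t. P r (s + s') t = P r s t + P r s' t" "\<And>r t. P r 0 t = 0"
    "\<And>r s t t'. P r s (t + t') = P r s t + P r s t'" "\<And>r s. P r s 0 = 0"
    "\<And>r r' s t. Q (r + r') s t = Q r s t + Q r' s t" "\<And>s t. Q 0 s t = 0"
    "\<And>r s s' t. Q r (s + s') t = Q r s t + Q r s' t" "\<And>r t. Q r 0 t = 0"
    "\<And>r s t t'. Q r s (t + t') = Q r s t + Q r s t'" "\<And>r s. Q r s 0 = 0"
    and eq: "\<And>x a y b z c. P (x \<otimes> a) (y \<otimes> b) (z \<otimes> c) = Q (x \<otimes> a) (y \<otimes> b) (z \<otimes> c)"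
  shows "P r s t = Q r s t"
proof -
  have "P (x \<otimes> a) (y \<otimes> b) t = Q (x \<otimes> a) (y \<otimes> b) t" for x a y b
    by (induction t rule: tensor_induct) (simp_all add: assms)
  then have "P (x \<otimes> a) s t = Q (x \<otimes> a) s t" for x a
    by (induction s rule: tensor_induct) (simp_all add: assms)
  then show ?thesis
    by (induction r rule: tensor_induct) (simp_all add: assms)
qed

text \<open>The universal property is applied twice, to one argument at a time with the other as a
  parameter. Uniqueness is \<open>bilinear_eqI\<close>.\<close>

lemma ex1_bilinear_extension:
  assumes W: "vector_space sW"
    and f: "\<And>x a. bilinear_map sA sB sW (f x a)"
    and f': "\<And>y b. bilinear_map sA sB sW (\<lambda>x a. f x a y b)"
  shows "\<exists>!g. bilinear_map sT sT sW g \<and> (\<forall>x y a b. g (x \<otimes> a) (y \<otimes> b) = f x a y b)"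
proof (rule ex_ex1I)
  interpret W: vector_space sW by fact
  \<comment> \<open>First extension: for fixed \<open>x\<close> and \<open>a\<close>, the map in
    \<open>(y, b)\<close> becomes a linear map \<open>G x a\<close>.\<close>
  from universal_property[OF f W]
  have "\<exists>g. Vector_Spaces.linear sT sW g \<and> (\<forall>y b. g (y \<otimes> b) = f x a y b)" for x a
    by blast
  then obtain G where G: "Vector_Spaces.linear sT sW (G x a)" "G x a (y \<otimes> b) = f x a y b"
    for x a y b by metis
  have G_simps: "G x a (s + t) = G x a s + G x a t" "G x a (sT c t) = sW c (G x a t)"
    "G x a 0 = 0" for x a s t c
  proof -
    interpret Vector_Spaces.linear sT sW "G x a" by (rule G)
    show "G x a (s + t) = G x a s + G x a t" "G x a (sT c t) = sW c (G x a t)" "G x a 0 = 0"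
      by (rule add scale zero)+
  qed
  \<comment> \<open>For pure \<open>t\<close> this is \<open>f'\<close>, and linearity of
    \<open>G x a\<close> carries it to sums. The second extension, in \<open>(x, a)\<close> with
    \<open>t\<close> as a parameter, thus becomes possible.\<close>
  have "bilinear_map sA sB sW (\<lambda>x a. G x a t)" for t
  proof -
    note f'_simps = bilinear_map_simps[OF f']
    have "G (x + y) a t = G x a t + G y a t" "G x (a + b) t = G x a t + G x b t"
      "G (sA c x) a t = sW c (G x a t)" "G x (sB c a) t = sW c (G x a t)" for x y a b c
      by (induction t rule: tensor_induct)
        (simp_all add: G G_simps f'_simps W.scale_right_distrib)
    then show ?thesis
      using W A.vector_space_axioms B.vector_space_axioms by (simp add: bilinear_map_iff)
  qed
  from universal_property[OF this W]
  have "\<exists>h. Vector_Spaces.linear sT sW h \<and> (\<forall>x a. h (x \<otimes> a) = G x a t)" for t by blast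
  then obtain H where H: "Vector_Spaces.linear sT sW (H t)" "H t (x \<otimes> a) = G x a t"
    for t x a by metis
  have H_simps: "H t (s + s') = H t s + H t s'" "H t (sT c s) = sW c (H t s)" "H t 0 = 0"
    for t s s' c
  proof -
    interpret Vector_Spaces.linear sT sW "H t" by (rule H)
    show "H t (s + s') = H t s + H t s'" "H t (sT c s) = sW c (H t s)" "H t 0 = 0"
      by (rule add scale zero)+
  qed
  \<comment> \<open>Each \<open>H t\<close> is linear by construction. Linearity in the parameter
    \<open>t\<close> is checked on pure \<open>s\<close>, where \<open>H t s\<close> is a value of
    some \<open>G x a\<close>, and passes to sums.\<close>
  have "H (t + t') s = H t s + H t' s" "H (sT c t) s = sW c (H t s)" for t t' s c
    by (induction s rule: tensor_induct)
      (simp_all add: H H_simps G_simps W.scale_right_distrib)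
  then have "bilinear_map sT sT sW (\<lambda>s t. H t s)"
    using W T.vector_space_axioms by (simp add: bilinear_map_iff H_simps)
  \<comment> \<open>\<open>H\<close> takes the second argument of the bilinear map first, hence the
    swap in the witness.\<close>
  then show "\<exists>g. bilinear_map sT sT sW g \<and> (\<forall>x y a b. g (x \<otimes> a) (y \<otimes> b) = f x a y b)"
    by (intro exI[of _ "\<lambda>s t. H t s"]) (simp add: H G)
qed (auto intro: bilinear_eqI)

section \<open>Finite dimension and nondegeneracy\<close>

text \<open>Tensors of elements of two finite spanning sets span: the condition that
  \<open>x \<otimes> a\<close> lies in their span defines a subspace in each factor, so span
  induction reduces first \<open>x\<close> and then \<open>a\<close> to the spanning sets.\<close>

lemma fin_dim_tensor:
  assumes "fin_dim_vector_space sA" "fin_dim_vector_space sB"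
  shows "fin_dim_vector_space sT"
proof unfold_locales
  obtain S where S: "finite S" "A.span S = UNIV"
    using fin_dim_vector_space.finite_spanning_set[OF assms(1)] by blast
  obtain S' where S': "finite S'" "B.span S' = UNIV"
    using fin_dim_vector_space.finite_spanning_set[OF assms(2)] by blast
  let ?F = "(\<lambda>(x, a). x \<otimes> a) ` (S \<times> S')"
  have pure: "x \<otimes> a \<in> T.span ?F" for x a
  proof (rule A.span_induct[of x S])
    show "A.subspace {x. x \<otimes> a \<in> T.span ?F}"
      by (rule A.subspaceI) (simp_all add: tensor_simps T.span_zero T.span_add T.span_scale)
    show "x \<otimes> a \<in> T.span ?F" if "x \<in> S" for x
    proof (rule B.span_induct[of a S'])
      show "B.subspace {a. x \<otimes> a \<in> T.span ?F}"
        by (rule B.subspaceI) (simp_all add: tensor_simps T.span_zero T.span_add T.span_scale)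
      show "x \<otimes> a \<in> T.span ?F" if "a \<in> S'" for a
        using that \<open>x \<in> S\<close> by (intro T.span_base) auto
    qed (simp add: S')
  qed (simp add: S)
  have "t \<in> T.span ?F" for t
    by (induction t rule: tensor_induct) (simp_all add: pure T.span_zero T.span_add)
  then show "\<exists>S. finite S \<and> T.span S = UNIV"
    using S(1) S'(1) by (intro exI[of _ ?F]) auto
qed

text \<open>Expanding the right factor of a pure tensor in \<open>S\<close> and moving the scalars
  across the tensor sign leaves coefficients in \<open>A\<close>. For a sum of tensors the
  coefficients add.\<close>

lemma tensor_expansion:
  assumes S: "finite S" "B.span S = UNIV"
  shows "\<exists>\<xi>. t = (\<Sum>b\<in>S. \<xi> b \<otimes> b)"
proof (induction t rule: tensor_induct)
  case zero
  show ?case by (rule exI[of _ "\<lambda>_. 0"]) (simp add: tensor_simps)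
next
  case (pure x a)
  have "a \<in> range (\<lambda>r. \<Sum>b\<in>S. sB (r b) b)"
    using S by (simp flip: B.span_finite)
  then obtain r where "a = (\<Sum>b\<in>S. sB (r b) b)" by blast
  then have "x \<otimes> a = (\<Sum>b\<in>S. sA (r b) x \<otimes> b)"
    by (simp add: bilinear_map_sum_right[OF bilinear_tensor] tensor_simps)
  then show ?case by (intro exI[of _ "\<lambda>b. sA (r b) x"])
next
  case (add s t)
  then obtain \<xi> \<zeta> where "s = (\<Sum>b\<in>S. \<xi> b \<otimes> b)" "t = (\<Sum>b\<in>S. \<zeta> b \<otimes> b)" by blast
  then have "s + t = (\<Sum>b\<in>S. (\<xi> b + \<zeta> b) \<otimes> b)"
    by (simp add: tensor_simps sum.distrib)
  then show ?case by (intro exI[of _ "\<lambda>b. \<xi> b + \<zeta> b"])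
qed

text \<open>The left radical suffices for the application, since a skew-symmetric form has equal
  left and right radicals.\<close>

lemma tensor_form_left_nondegenerate:
  assumes B: "fin_dim_vector_space sB"
    and \<alpha>: "nondegenerate \<alpha>"
    and \<beta>: "bilinear_form sB \<beta>" "nondegenerate \<beta>"
    and \<gamma>: "bilinear_form sT \<gamma>" "\<And>x a y b. \<gamma> (x \<otimes> a) (y \<otimes> b) = \<alpha> x y * \<beta> a b"
    and t: "\<And>s. \<gamma> t s = 0"
  shows "t = 0"
proof -
  obtain S where S: "finite S" "B.independent S" "B.span S = UNIV"
    using fin_dim_vector_space.finite_basis[OF B] by blast
  obtain \<xi> where \<xi>: "t = (\<Sum>b\<in>S. \<xi> b \<otimes> b)"
    using tensor_expansion[OF S(1,3)] by blast
  \<comment> \<open>Contracting the left factor of \<open>t\<close> against \<open>y\<close> yields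
    a vector of \<open>B\<close> whose pairing with \<open>c\<close> is
    \<open>\<gamma> t (y \<otimes> c)\<close>.\<close>
  have "\<beta> (\<Sum>b\<in>S. sB (\<alpha> (\<xi> b) y) b) c = 0" for y c
  proof -
    have "\<beta> (\<Sum>b\<in>S. sB (\<alpha> (\<xi> b) y) b) c = (\<Sum>b\<in>S. \<alpha> (\<xi> b) y * \<beta> b c)"
      by (simp add: bilinear_map_sum_left[OF \<beta>(1)] bilinear_map_simps[OF \<beta>(1)])
    also have "\<dots> = \<gamma> t (y \<otimes> c)"
      by (simp add: \<xi> bilinear_map_sum_left[OF \<gamma>(1)] \<gamma>(2))
    finally show ?thesis by (simp add: t)
  qed
  then have "(\<Sum>b\<in>S. sB (\<alpha> (\<xi> b) y) b) = 0" for y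
    using \<beta>(2) by (simp add: nondegenerate_def)
  then have "\<alpha> (\<xi> b) y = 0" if "b \<in> S" for b y
    using that B.independentD[OF S(2) S(1) subset_refl, of "\<lambda>b. \<alpha> (\<xi> b) y" b] by simp
  then have "\<xi> b = 0" if "b \<in> S" for b
    using that \<alpha> by (simp add: nondegenerate_def)
  then show "t = 0" by (simp add: \<xi> tensor_simps)
qed

end

section \<open>The Frobenius dialgebra on the tensor product\<close>

text \<open>The given formulas fix values on pure tensors only. Unique existence of the bilinear
  extensions makes them genuine definitions, after which the structure is asserted for whichever
  maps have these values.\<close>

theorem proposition2p22:
  fixes sA :: "'f::field_char_0 \<Rightarrow> 'a::ab_group_add \<Rightarrow> 'a"
    and mult_A :: "'a \<Rightarrow> 'a \<Rightarrow> 'a"  (infixl "\<circ>\<^sub>A" 80)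
    and form_A :: "'a \<Rightarrow> 'a \<Rightarrow> 'f"
    and sB :: "'f \<Rightarrow> 'b::ab_group_add \<Rightarrow> 'b"
    and mult_B :: "'b \<Rightarrow> 'b \<Rightarrow> 'b"  (infixl "\<cdot>\<^sub>B" 80)
    and form_B :: "'b \<Rightarrow> 'b \<Rightarrow> 'f"
    and sT :: "'f \<Rightarrow> 't::ab_group_add \<Rightarrow> 't"
    and tensor :: "'a \<Rightarrow> 'b \<Rightarrow> 't"  (infixl "\<otimes>" 75)
  assumes "quadratic_perm_algebra sA mult_A form_A"
    and "symmetric_Frobenius_algebra sB mult_B form_B"
    and "tensor_product sA sB sT tensor"
  shows
    "(\<exists>!rmult. bilinear_product sT rmult \<and>
        (\<forall>x y a b. rmult (x \<otimes> a) (y \<otimes> b) = (x \<circ>\<^sub>A y) \<otimes> (a \<cdot>\<^sub>B b))) \<and>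
     (\<exists>!lmult. bilinear_product sT lmult \<and>
        (\<forall>x y a b. lmult (x \<otimes> a) (y \<otimes> b) = (y \<circ>\<^sub>A x) \<otimes> (a \<cdot>\<^sub>B b))) \<and>
     (\<exists>!form. bilinear_form sT form \<and>
        (\<forall>x y a b. form (x \<otimes> a) (y \<otimes> b) = form_A x y * form_B a b)) \<and>
     (\<forall>rmult lmult form.
        bilinear_product sT rmult \<and>
        (\<forall>x y a b. rmult (x \<otimes> a) (y \<otimes> b) = (x \<circ>\<^sub>A y) \<otimes> (a \<cdot>\<^sub>B b)) \<and>
        bilinear_product sT lmult \<and>
        (\<forall>x y a b. lmult (x \<otimes> a) (y \<otimes> b) = (y \<circ>\<^sub>A x) \<otimes> (a \<cdot>\<^sub>B b)) \<and>
        bilinear_form sT form \<and>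
        (\<forall>x y a b. form (x \<otimes> a) (y \<otimes> b) = form_A x y * form_B a b)
        \<longrightarrow> skew_symmetric_Frobenius_dialgebra sT rmult lmult form)"
proof -
  interpret A: quadratic_perm_algebra sA mult_A form_A by fact
  interpret B: symmetric_Frobenius_algebra sB mult_B form_B by fact
  interpret tensor_product sA sB sT tensor by fact
  note A_simps = bilinear_map_simps[OF A.bilinear] bilinear_map_simps[OF A.form_bilinear]
  note B_simps = bilinear_map_simps[OF B.bilinear] bilinear_map_simps[OF B.form_bilinear]
  note vs = A.vector_space_axioms B.vector_space_axioms T.vector_space_axioms
    vector_space_times

  \<comment> \<open>The side conditions are that the prescribed value is bilinear in
    \<open>(y, b)\<close> and in \<open>(x, a)\<close> separately.\<close>
  have "\<exists>!rmult. bilinear_product sT rmult \<and>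
      (\<forall>x y a b. rmult (x \<otimes> a) (y \<otimes> b) = (x \<circ>\<^sub>A y) \<otimes> (a \<cdot>\<^sub>B b))"
    by (rule ex1_bilinear_extension)
      (simp_all add: bilinear_map_iff vs A_simps B_simps tensor_simps)
  moreover have "\<exists>!lmult. bilinear_product sT lmult \<and>
      (\<forall>x y a b. lmult (x \<otimes> a) (y \<otimes> b) = (y \<circ>\<^sub>A x) \<otimes> (a \<cdot>\<^sub>B b))"
    by (rule ex1_bilinear_extension)
      (simp_all add: bilinear_map_iff vs A_simps B_simps tensor_simps)
  moreover have "\<exists>!form. bilinear_form sT form \<and>
      (\<forall>x y a b. form (x \<otimes> a) (y \<otimes> b) = form_A x y * form_B a b)"
    by (rule ex1_bilinear_extension)
      (simp_all add: bilinear_map_iff vs A_simps B_simps algebra_simps)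
  moreover have "skew_symmetric_Frobenius_dialgebra sT rmult lmult form"
    if R: "bilinear_product sT rmult"
        "\<And>x y a b. rmult (x \<otimes> a) (y \<otimes> b) = (x \<circ>\<^sub>A y) \<otimes> (a \<cdot>\<^sub>B b)"
      and L: "bilinear_product sT lmult"
        "\<And>x y a b. lmult (x \<otimes> a) (y \<otimes> b) = (y \<circ>\<^sub>A x) \<otimes> (a \<cdot>\<^sub>B b)"
      and F: "bilinear_form sT form"
        "\<And>x y a b. form (x \<otimes> a) (y \<otimes> b) = form_A x y * form_B a b"
    for rmult lmult form
  proof -
    note simps = bilinear_map_simps[OF R(1)] bilinear_map_simps[OF L(1)]
      bilinear_map_simps[OF F(1)] R(2) L(2) F(2)
    have skew: "form s t = - form t s" for s t
    proof -
      \<comment> \<open>Both sides are bilinear, so pure tensors decide; there a skew factor times a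
        symmetric factor is skew.\<close>
      have "form = (\<lambda>s t. - form t s)"
      proof (rule bilinear_eqI[OF F(1)])
        show "bilinear_form sT (\<lambda>s t. - form t s)"
          by (simp add: bilinear_map_iff vs simps)
        show "form (x \<otimes> a) (y \<otimes> b) = - form (y \<otimes> b) (x \<otimes> a)" for x a y b
        proof -
          have "form_A x y = - form_A y x" "form_B a b = form_B b a"
            using A.form_skew B.form_symmetric
            unfolding skew_symmetric_form_def symmetric_form_def by blast+
          then show ?thesis by (simp add: F(2))
        qed
      qed
      then show ?thesis by (rule fun_cong[THEN fun_cong])
    qed
    have fin_dim: "fin_dim_vector_space sT"
      by (rule fin_dim_tensor) unfold_locales
    have nondegenerate: "t = 0" if "\<And>s. form t s = 0" for t
      using that
      by (rule tensor_form_left_nondegenerate[OF B.fin_dim_vector_space_axioms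
            A.form_nondegenerate B.form_bilinear B.form_nondegenerate F])
    interpret fin_dim_vector_space sT by (rule fin_dim)
    show ?thesis
    proof unfold_locales
      show "bilinear_product sT rmult" "bilinear_product sT lmult" "bilinear_form sT form"
        by fact+
      show "nondegenerate form"
        unfolding nondegenerate_def
      proof (intro conjI allI impI)
        show "t = 0" if "\<forall>s. form t s = 0" for t
          using that nondegenerate by blast
        \<comment> \<open>Skew-symmetry turns the right radical into the left one.\<close>
        show "t = 0" if "\<forall>s. form s t = 0" for t
          by (rule nondegenerate, subst skew) (simp add: that)
      qed
      show "skew_symmetric_form form"
        unfolding skew_symmetric_form_def using skew by blast
    next
      fix r s t
      show "rmult (rmult r s) t = rmult r (rmult s t)"
        by (rule trilinear_eqI[where P = "\<lambda>r s t. rmult (rmult r s) t" and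
            Q = "\<lambda>r s t. rmult r (rmult s t)"]) (simp_all add: simps A.assoc B.assoc)
      show "lmult (lmult r s) t = lmult r (lmult s t)"
        by (rule trilinear_eqI[where P = "\<lambda>r s t. lmult (lmult r s) t" and
            Q = "\<lambda>r s t. lmult r (lmult s t)"]) (simp_all add: simps A.assoc B.assoc)
      \<comment> \<open>On the \<open>A\<close> factor, this and the next two axioms reduce, after
        reassociation, to the law that the two left multipliers commute; the \<open>B\<close> factor
        needs associativity only.\<close>
      show "lmult (lmult r s) t = lmult r (rmult s t)"
        by (rule trilinear_eqI[where P = "\<lambda>r s t. lmult (lmult r s) t" and
            Q = "\<lambda>r s t. lmult r (rmult s t)"]) (simp_all add: simps A.assoc B.assoc A.left_commute)
      show "lmult (rmult r s) t = rmult r (lmult s t)"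
        by (rule trilinear_eqI[where P = "\<lambda>r s t. lmult (rmult r s) t" and
            Q = "\<lambda>r s t. rmult r (lmult s t)"]) (simp_all add: simps B.assoc A.left_commute)
      show "rmult (lmult r s) t = rmult r (rmult s t)"
        by (rule trilinear_eqI[where P = "\<lambda>r s t. rmult (lmult r s) t" and
            Q = "\<lambda>r s t. rmult r (rmult s t)"]) (simp_all add: simps A.assoc B.assoc A.left_commute)
      \<comment> \<open>On pure tensors both products share the \<open>B\<close> factor, so their
        difference is the commutator in \<open>A\<close> tensored with it, as invariance of
        \<open>form_A\<close> demands.\<close>
      show "form (rmult r s) t = form r (rmult s t - lmult s t)"
        by (rule trilinear_eqI[where P = "\<lambda>r s t. form (rmult r s) t" and
            Q = "\<lambda>r s t. form r (rmult s t - lmult s t)"])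
          (simp_all add: simps A.form_invariant B.form_invariant A_simps algebra_simps)
      \<comment> \<open>The \<open>A\<close> factor of \<open>lmult r s\<close> is reversed, so the
        derived invariance for the opposite product applies.\<close>
      show "form (lmult r s) t = form r (rmult s t)"
        by (rule trilinear_eqI[where P = "\<lambda>r s t. form (lmult r s) t" and
            Q = "\<lambda>r s t. form r (rmult s t)"]) (simp_all add: simps A.form_invariant_opposite B.form_invariant)
    qed
  qed
  ultimately show ?thesis
    by (intro conjI allI impI) (assumption | simp)+
qed

end
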